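(* Let $n \ge 3$ be an integer, let $S$ be the skew-butterfly poset, and let $\mathcal{A} \subset 2^{[n]}$ be a collection of sets not containing $S$ as a subposet. Assume that $\varnothing \notin \mathcal{A}$ and $[n] \notin \mathcal{A}$. Then $$\sum_{A\in \mathcal{A}} \frac{1}{\binom{n}{|A|}} \le 2.$$
   Context: $[n]=\{1,\dots,n\}$ and $2^{[n]}$ is its power set. A family $\mathcal{A}\subset 2^{[n]}$ is viewed as a poset under inclusion. A poset $P$ is a (weak) subposet of a poset $Q$ if there is an injection $\phi:P\to Q$ such that $x\le y$ in $P$ implies $\phi(x)\le\phi(y)$ in $Q$; "subposet" means weak subposet. The skew-butterfly $S$ is the poset on $5$ distinct elements $a,b,c,d,e$ whose order is generated by the relations $a\le c$, $a\le d$, $b\le c$, $b\le d$ and $b\le e\le d$. *)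

theory Defs
  imports Complex_Main
begin

datatype skew_butterfly = Sa | Sb | Sc | Sd | Se

inductive skew_gen :: "skew_butterfly \<Rightarrow> skew_butterfly \<Rightarrow> bool" where
  "skew_gen Sa Sc"
| "skew_gen Sa Sd"
| "skew_gen Sb Sc"
| "skew_gen Sb Sd"
| "skew_gen Sb Se"
| "skew_gen Se Sd"

definition skew_le :: "skew_butterfly \<Rightarrow> skew_butterfly \<Rightarrow> bool" where
  "skew_le = skew_gen\<^sup>*\<^sup>*"

(* The map need not reflect the order: this is the weak (not the induced) notion. *)
definition weak_subposet ::
  "'a set \<Rightarrow> ('a \<Rightarrow> 'a \<Rightarrow> bool) \<Rightarrow> 'b set \<Rightarrow> ('b \<Rightarrow> 'b \<Rightarrow> bool) \<Rightarrow> bool" where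
  "weak_subposet P leP Q leQ \<longleftrightarrow>
     (\<exists>\<phi>. inj_on \<phi> P \<and> \<phi> ` P \<subseteq> Q \<and> monotone_on P leP leQ \<phi>)"

fun skew_rank :: "skew_butterfly \<Rightarrow> nat" where
  "skew_rank Sa = 0"
| "skew_rank Sb = 0"
| "skew_rank Se = 1"
| "skew_rank Sc = 2"
| "skew_rank Sd = 2"

lemma skew_le_rank:
  assumes "skew_le x y"
  shows "x = y \<or> skew_rank x < skew_rank y"
  using assms unfolding skew_le_def
proof (induction rule: rtranclp_induct)
  case base
  then show ?case by simp
next
  case (step y z)
  from step.hyps(2) have "skew_rank y < skew_rank z"
    by cases simp_all
  with step.IH show ?case by auto
qed

lemma order_skew_le: "class.order skew_le (\<lambda>x y. skew_le x y \<and> x \<noteq> y)"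
proof
  fix x y z
  show "(skew_le x y \<and> x \<noteq> y) \<longleftrightarrow> skew_le x y \<and> \<not> skew_le y x"
    by (metis skew_le_rank less_asym skew_le_def rtranclp.rtrancl_refl)
  show "skew_le x x" by (simp add: skew_le_def)
  show "skew_le x y \<Longrightarrow> skew_le y z \<Longrightarrow> skew_le x z"
    unfolding skew_le_def by (rule rtranclp_trans)
  show "skew_le x y \<Longrightarrow> skew_le y x \<Longrightarrow> x = y"
    by (metis skew_le_rank less_asym)
qed

end

theory Submission
  imports Defs "HOL-Combinatorics.Multiset_Permutations"
begin

text \<open>
An ordering of the ground set \<open>V\<close> is a maximal chain: its prefixes are the sets of the chain. The
left-hand side is the average, over all orderings, of the number of members of the family that lie on
the chain (\<open>lubell_sum_eq_average\<close>), so the claim is that this number is at most \<open>2\<close> on average.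
A chain that carries \<open>k \<ge> 2\<close> members has \<open>k - 2\<close> of them strictly between two others; call these
interior. Hence it suffices to inject the pairs (chain, interior member) into the chains that
carry exactly one member (\<open>card_interior_pairs_le\<close>).

Let \<open>B\<close> be interior on a chain, with \<open>A \<subset> B \<subset> C\<close> on the same chain. There are two cases.

If the members below \<open>B\<close> form a chain and the members above \<open>B\<close> form a chain, then reverse both the
part of the ordering that enumerates \<open>B\<close> and the part after it. The new chain meets the family
in \<open>B\<close> alone (\<open>reversal_trace\<close>), because \<open>A\<close> and \<open>C\<close> are neither empty nor the whole ground set.

Otherwise the absence of a skew-butterfly forces \<open>A\<close> to be minimal, \<open>C\<close> to be maximal, and \<open>B\<close> to be
the only member strictly between them (\<open>nonlinear_thin\<close>). Now there are two ways of modifying the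
chain. Moving the first element \<open>z\<close> of \<open>C - B\<close> in front of the last element \<open>x\<close> of \<open>A\<close> bypasses \<open>A\<close>
and \<open>B\<close>, and leaves \<open>C\<close> as the only member unless \<open>A - {x} \<union> {z}\<close> is a member. Moving the last
element \<open>y\<close> of \<open>B - A\<close> behind the first element \<open>r\<close> outside \<open>C\<close> bypasses \<open>B\<close> and \<open>C\<close>, and leaves \<open>A\<close>
as the only member unless \<open>C - {y} \<union> {r}\<close> is a member. The two exceptional sets cannot both be
members: they are nested, and with \<open>A\<close>, \<open>B\<close>, \<open>C\<close> they would form a skew-butterfly
(\<open>some_detour_free\<close>). So one of the two detours is always available.

A detour need not determine the chain that it comes from, but whenever two chains collide under one
kind of detour, one of the two (the one with the larger \<open>A\<close>, or with the smaller \<open>C\<close>) has the other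
detour available as well, and no chain has both of these roles. This is enough to choose detours
injectively (\<open>detour_injection\<close>). The chains so obtained carry a minimal or a maximal member, so
they differ from those obtained by reversal, whose only member \<open>B\<close> is neither.
\<close>

section \<open>Orderings and their prefixes\<close>

definition prefix_sets :: "'a list \<Rightarrow> 'a set set" where
  "prefix_sets xs = {set us | us vs. xs = us @ vs}"

lemma prefix_setsI: "set us \<in> prefix_sets (us @ vs)"
  unfolding prefix_sets_def by blast

lemma prefix_sets_split:
  assumes "E \<in> prefix_sets (us @ vs)"
  shows "E \<subseteq> set us \<or> set us \<subseteq> E"
  using assms unfolding prefix_sets_def by (auto simp: append_eq_append_conv2)

lemma prefix_sets_chain:
  assumes "D \<in> prefix_sets xs" "E \<in> prefix_sets xs"
  shows "D \<subseteq> E \<or> E \<subseteq> D"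
  using assms prefix_sets_split unfolding prefix_sets_def by blast

lemma prefix_sets_append:
  assumes "E \<in> prefix_sets (us @ vs)"
  shows "E \<in> prefix_sets us \<or> (\<exists>D \<in> prefix_sets vs. E = set us \<union> D)"
proof -
  obtain as bs where "us @ vs = as @ bs" "E = set as"
    using assms unfolding prefix_sets_def by blast
  then consider cs where "us = as @ cs" | cs where "as = us @ cs" "vs = cs @ bs"
    by (auto simp: append_eq_append_conv2)
  then show ?thesis
    using \<open>E = set as\<close> unfolding prefix_sets_def by cases auto
qed

lemma prefix_sets_hd_last:
  assumes "E \<in> prefix_sets xs" "distinct xs" "E \<noteq> {}" "E \<noteq> set xs"
  shows "hd xs \<in> E" "last xs \<notin> E"
proof -
  obtain us vs where *: "xs = us @ vs" "E = set us"
    using assms(1) unfolding prefix_sets_def by blast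
  with assms have "us \<noteq> []" "vs \<noteq> []" by auto
  then have "hd us \<in> set us" "last vs \<in> set vs" by auto
  with * \<open>us \<noteq> []\<close> \<open>vs \<noteq> []\<close> assms(2) show "hd xs \<in> E" "last xs \<notin> E" by auto
qed

lemma prefix_sets_take:
  assumes "distinct xs" "E \<in> prefix_sets xs"
  shows "set (take (card E) xs) = E"
  using assms unfolding prefix_sets_def by (auto simp: distinct_card)

section \<open>The Lubell sum as an average over maximal chains\<close>

lemma card_orders_through:
  assumes "finite V" "E \<subseteq> V"
  shows "card {xs \<in> permutations_of_set V. E \<in> prefix_sets xs} = fact (card E) * fact (card V - card E)"
proof -
  have fE: "finite E" using assms finite_subset by blast
  have "bij_betw (\<lambda>(us, vs). us @ vs) (permutations_of_set E \<times> permutations_of_set (V - E))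
          {xs \<in> permutations_of_set V. E \<in> prefix_sets xs}"
  proof (rule bij_betw_imageI)
    show "inj_on (\<lambda>(us, vs). us @ vs) (permutations_of_set E \<times> permutations_of_set (V - E))"
      by (auto simp: inj_on_def dest!: length_finite_permutations_of_set)
    have "xs \<in> (\<lambda>(us, vs). us @ vs) ` (permutations_of_set E \<times> permutations_of_set (V - E))"
      if xs: "xs \<in> permutations_of_set V" and "E \<in> prefix_sets xs" for xs
    proof -
      from that(2) obtain us vs where "xs = us @ vs" "E = set us"
        unfolding prefix_sets_def by blast
      with xs have "us \<in> permutations_of_set E" "vs \<in> permutations_of_set (V - E)"
        by (auto simp: permutations_of_set_def)
      with \<open>xs = us @ vs\<close> show ?thesis by force
    qed
    then show "(\<lambda>(us, vs). us @ vs) ` (permutations_of_set E \<times> permutations_of_set (V - E)) =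
        {xs \<in> permutations_of_set V. E \<in> prefix_sets xs}"
      using assms(2) by (auto simp: permutations_of_set_def intro: prefix_setsI)
  qed
  then have "card {xs \<in> permutations_of_set V. E \<in> prefix_sets xs} =
      card (permutations_of_set E \<times> permutations_of_set (V - E))"
    by (simp add: bij_betw_same_card)
  then show ?thesis
    using assms fE by (simp add: card_cartesian_product card_Diff_subset)
qed

text \<open>
Double counting: a set \<open>E\<close> is a prefix of \<open>|E|! (|V| - |E|)!\<close> of the \<open>|V|!\<close> orderings.
\<close>

lemma lubell_sum_eq_average:
  fixes V :: "'a set"
  assumes "finite V" "F \<subseteq> Pow V"
  shows "(\<Sum>E\<in>F. 1 / real (card V choose card E)) =
         (\<Sum>xs\<in>permutations_of_set V. real (card (F \<inter> prefix_sets xs))) / fact (card V)"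
proof -
  have fF: "finite F" using assms finite_subset by blast
  have "(\<Sum>xs\<in>permutations_of_set V. card (F \<inter> prefix_sets xs))
      = (\<Sum>xs\<in>permutations_of_set V. card {E \<in> F. E \<in> prefix_sets xs})"
    by (simp add: Int_def)
  also have "\<dots> = (\<Sum>E\<in>F. card {xs \<in> permutations_of_set V. E \<in> prefix_sets xs})"
    by (rule sum_multicount_gen) (use fF in auto)
  also have "\<dots> = (\<Sum>E\<in>F. fact (card E) * fact (card V - card E))"
    using assms by (intro sum.cong refl card_orders_through) auto
  finally have *: "(\<Sum>xs\<in>permutations_of_set V. real (card (F \<inter> prefix_sets xs)))
      = (\<Sum>E\<in>F. fact (card E) * fact (card V - card E))"
    by (metis (mono_tags, lifting) of_nat_sum of_nat_mult of_nat_fact sum.cong)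
  have "1 / real (card V choose card E) = fact (card E) * fact (card V - card E) / fact (card V)"
    if "E \<in> F" for E
  proof -
    have "card E \<le> card V" using that assms by (auto intro: card_mono)
    then show ?thesis by (simp add: binomial_fact)
  qed
  then show ?thesis
    unfolding * sum_divide_distrib by (intro sum.cong) auto
qed

text \<open>
All but the least and the greatest set of a chain are interior; a one-element chain leaves a surplus
of one. These surpluses are what pays for the interior sets.
\<close>

lemma card_chain_le_interior:
  fixes T :: "'a set set"
  assumes "finite T" and chain: "\<And>D E. D \<in> T \<Longrightarrow> E \<in> T \<Longrightarrow> D \<subseteq> E \<or> E \<subseteq> D"
  shows "card T + (if card T = 1 then 1 else 0)
    \<le> 2 + card {B \<in> T. (\<exists>A\<in>T. A \<subset> B) \<and> (\<exists>C\<in>T. B \<subset> C)}" (is "_ \<le> 2 + card ?I")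
proof (cases "T = {}")
  case False
  then obtain m where m: "m \<in> T" "\<And>E. E \<in> T \<Longrightarrow> E \<subseteq> m \<Longrightarrow> m = E"
    using finite_has_minimal[OF assms(1)] by metis
  obtain M where M: "M \<in> T" "\<And>E. E \<in> T \<Longrightarrow> M \<subseteq> E \<Longrightarrow> M = E"
    using False finite_has_maximal[OF assms(1)] by metis
  have "T \<subseteq> ?I \<union> {m, M}"
  proof
    fix B assume "B \<in> T"
    with m M chain[of B m] chain[of B M] show "B \<in> ?I \<union> {m, M}" by blast
  qed
  then have "card T \<le> card (?I \<union> {m, M})"
    using assms(1) by (intro card_mono) auto
  also have "\<dots> \<le> card ?I + card {m, M}" by (rule card_Un_le)
  also have "card {m, M} \<le> 2" by (simp add: card_insert_if)
  finally show ?thesis by auto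
qed simp

section \<open>Flags and their detours\<close>

lemma append_eq_longer:
  assumes "as @ bs = cs @ ds" "length as \<le> length cs"
  obtains es where "cs = as @ es" "bs = es @ ds"
  using assms by (auto simp: append_eq_append_conv2)

text \<open>
An ordering together with three marked prefixes \<open>A \<subset> B \<subset> C\<close>, cut at the places where the detours
rearrange it: \<open>A\<close> is enumerated by \<open>P @ [x]\<close>, \<open>B - A\<close> by \<open>Y @ [y]\<close>, \<open>C - B\<close> by \<open>z # Z\<close>, and the rest
by \<open>r # Q\<close>. The three steps and the two ends are nonempty, so the elements \<open>x\<close>, \<open>y\<close>, \<open>z\<close>, \<open>r\<close> exist.
\<close>

datatype 'a flag = Flag "'a list" 'a "'a list" 'a 'a "'a list" 'a "'a list"

fun order_of :: "'a flag \<Rightarrow> 'a list" where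
  "order_of (Flag P x Y y z Z r Q) = P @ x # Y @ y # z # Z @ r # Q"

fun lower_set :: "'a flag \<Rightarrow> 'a set" where
  "lower_set (Flag P x Y y z Z r Q) = insert x (set P)"

fun middle_set :: "'a flag \<Rightarrow> 'a set" where
  "middle_set (Flag P x Y y z Z r Q) = insert x (insert y (set P \<union> set Y))"

fun upper_set :: "'a flag \<Rightarrow> 'a set" where
  "upper_set (Flag P x Y y z Z r Q) = insert x (insert y (insert z (set P \<union> set Y \<union> set Z)))"

text \<open>
Taking \<open>z\<close> before \<open>x\<close> keeps every prefix inside \<open>C\<close> different from \<open>A\<close> and from \<open>B\<close>. The prefixes
of \<open>P\<close> lie properly inside \<open>A\<close>, and those that contain both \<open>z\<close> and \<open>x\<close> contain \<open>A\<close>; the only prefix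
inside \<open>C\<close> that is not comparable with \<open>A\<close> is \<open>low_obstacle\<close>.
\<close>

fun low_detour :: "'a flag \<Rightarrow> 'a list" where
  "low_detour (Flag P x Y y z Z r Q) = P @ z # x # Y @ y # Z @ r # Q"

fun low_obstacle :: "'a flag \<Rightarrow> 'a set" where
  "low_obstacle (Flag P x Y y z Z r Q) = insert z (set P)"

text \<open>
The mirror image of \<open>low_detour\<close> under complementation: \<open>y\<close> is postponed until after \<open>r\<close>, and the
only prefix containing \<open>A\<close> that is not comparable with \<open>C\<close> is \<open>high_obstacle\<close>.
\<close>

fun high_detour :: "'a flag \<Rightarrow> 'a list" where
  "high_detour (Flag P x Y y z Z r Q) = P @ x # Y @ z # Z @ r # y # Q"

fun high_obstacle :: "'a flag \<Rightarrow> 'a set" where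
  "high_obstacle (Flag P x Y y z Z r Q) = insert x (insert z (insert r (set P \<union> set Y \<union> set Z)))"

section \<open>Skew-butterfly-free families\<close>

locale skew_free_family =
  fixes V :: "'a set" and F :: "'a set set"
  assumes finite_V: "finite V"
    and F_sub: "F \<subseteq> Pow V"
    and empty_notin: "{} \<notin> F"
    and V_notin: "V \<notin> F"
    and no_skew: "\<And>a b c d e. \<lbrakk>a \<in> F; b \<in> F; c \<in> F; d \<in> F; e \<in> F; distinct [a, b, c, d, e];
      a \<subseteq> c; a \<subseteq> d; b \<subseteq> c; b \<subseteq> e; e \<subseteq> d\<rbrakk> \<Longrightarrow> False"
begin

definition trace :: "'a list \<Rightarrow> 'a set set" where
  "trace xs = F \<inter> prefix_sets xs"

definition interior :: "'a list \<Rightarrow> 'a set set" where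
  "interior xs = {B \<in> trace xs. (\<exists>A\<in>trace xs. A \<subset> B) \<and> (\<exists>C\<in>trace xs. B \<subset> C)}"

definition linear_member :: "'a set \<Rightarrow> bool" where
  "linear_member B \<longleftrightarrow>
     (\<forall>D\<in>F. \<forall>E\<in>F. D \<subset> B \<longrightarrow> E \<subset> B \<longrightarrow> D \<subseteq> E \<or> E \<subseteq> D) \<and>
     (\<forall>D\<in>F. \<forall>E\<in>F. B \<subset> D \<longrightarrow> B \<subset> E \<longrightarrow> D \<subseteq> E \<or> E \<subseteq> D)"

lemma finite_F: "finite F"
  using finite_V F_sub finite_subset by blast

text \<open>
Every nonempty proper prefix of \<open>us\<close> contains the first element of \<open>us\<close> and misses its last. For a member
\<open>E\<close> on the reversed chain the two roles are exchanged, so \<open>E\<close> and \<open>A\<close> would be incomparable, against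
\<open>linear_member\<close>. The same argument applies to \<open>vs\<close> and the members above.
\<close>

lemma reversal_trace:
  assumes xs: "us @ vs \<in> permutations_of_set V" and B: "set us \<in> F"
    and lin: "linear_member (set us)"
    and A: "A \<in> trace (us @ vs)" "A \<subset> set us"
    and C: "C \<in> trace (us @ vs)" "set us \<subset> C"
  shows "trace (rev us @ rev vs) = {set us}"
proof -
  have dist: "distinct us" "distinct vs" and disj: "set us \<inter> set vs = {}"
    and V: "V = set us \<union> set vs"
    using xs by (auto simp: permutations_of_set_def)
  have below: "E \<in> prefix_sets as" if "E \<in> prefix_sets (as @ bs)" "E \<subset> set as"
    for E and as bs :: "'a list"
    using prefix_sets_append[OF that(1)] that(2) by blast
  have above: "\<exists>D \<in> prefix_sets bs. E = set as \<union> D"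
    if "E \<in> prefix_sets (as @ bs)" "set as \<subset> E" for E and as bs :: "'a list"
    using prefix_sets_append[OF that(1)] that(2) unfolding prefix_sets_def by auto
  have AC: "A \<in> F" "C \<in> F" using A C by (auto simp: trace_def)
  have "E = set us" if E: "E \<in> trace (rev us @ rev vs)" for E
  proof (rule ccontr)
    assume ne: "E \<noteq> set us"
    have EF: "E \<in> F" and Ep: "E \<in> prefix_sets (rev us @ rev vs)"
      using E by (auto simp: trace_def)
    consider "E \<subset> set us" | "set us \<subset> E"
      using prefix_sets_split[OF Ep] ne by auto
    then show False
    proof cases
      case 1
      have "A \<noteq> {}" "E \<noteq> {}" using AC EF empty_notin by auto
      then have "hd us \<in> A" "last us \<notin> A" "hd (rev us) \<in> E" "last (rev us) \<notin> E"
        using prefix_sets_hd_last[of A us] prefix_sets_hd_last[of E "rev us"]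
          below[of A us vs] below[of E "rev us" "rev vs"] A Ep 1 dist
        by (auto simp: trace_def)
      then show False
        using lin 1 A(2) AC EF unfolding linear_member_def
        by (metis hd_rev last_rev subsetD)
    next
      case 2
      obtain D where D: "D \<in> prefix_sets vs" "C = set us \<union> D"
        using above[of C us vs] C by (auto simp: trace_def)
      obtain D' where D': "D' \<in> prefix_sets (rev vs)" "E = set us \<union> D'"
        using above[of E "rev us" "rev vs"] Ep 2 by auto
      have "D \<noteq> {}" "D' \<noteq> {}" using C(2) 2 D D' by auto
      moreover have "D \<noteq> set vs" "D' \<noteq> set vs" using AC EF V V_notin D D' by auto
      ultimately have "hd vs \<in> D" "last vs \<notin> D" "hd (rev vs) \<in> D'" "last (rev vs) \<notin> D'"
        using prefix_sets_hd_last[OF D(1)] prefix_sets_hd_last[OF D'(1)] dist by auto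
      moreover have "vs \<noteq> []" using D \<open>D \<noteq> {}\<close> by (auto simp: prefix_sets_def)
      then have "hd vs \<notin> set us" "last vs \<notin> set us" using disj by auto
      ultimately have "hd vs \<in> C - E" "last vs \<in> E - C"
        using D D' by (auto simp: hd_rev last_rev)
      then show False
        using lin 2 C(2) AC EF unfolding linear_member_def by blast
    qed
  qed
  moreover have "set us \<in> trace (rev us @ rev vs)"
    using B prefix_setsI[of "rev us" "rev vs"] by (simp add: trace_def)
  ultimately show ?thesis by blast
qed

text \<open>
If \<open>B\<close> has two incomparable members above it, every violation of one of the conclusions yields a
skew-butterfly among \<open>A\<close>, \<open>B\<close>, \<open>C\<close>, the violating set and a further member above \<open>B\<close>. The case
of two incomparable members below is dual, the skew-butterfly being isomorphic to its own dual.
\<close>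

lemma nonlinear_thin:
  assumes F: "A \<in> F" "B \<in> F" "C \<in> F" and sub: "A \<subset> B" "B \<subset> C"
    and nonlin: "\<not> linear_member B"
  shows "\<And>E. E \<in> F \<Longrightarrow> E \<subseteq> A \<Longrightarrow> E = A"
    and "\<And>E. E \<in> F \<Longrightarrow> C \<subseteq> E \<Longrightarrow> E = C"
    and "\<And>E. E \<in> F \<Longrightarrow> A \<subset> E \<Longrightarrow> E \<subset> C \<Longrightarrow> E = B"
proof -
  have "(\<forall>E\<in>F. E \<subseteq> A \<longrightarrow> E = A) \<and> (\<forall>E\<in>F. C \<subseteq> E \<longrightarrow> E = C) \<and>
      (\<forall>E\<in>F. A \<subset> E \<longrightarrow> E \<subset> C \<longrightarrow> E = B)"
  proof (cases "\<forall>D\<in>F. \<forall>E\<in>F. B \<subset> D \<longrightarrow> B \<subset> E \<longrightarrow> D \<subseteq> E \<or> E \<subseteq> D")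
    case False
    then obtain C1 C2 where up: "C1 \<in> F" "C2 \<in> F" "B \<subset> C1" "B \<subset> C2"
      "\<not> C1 \<subseteq> C2" "\<not> C2 \<subseteq> C1" by blast
    obtain C' where C': "C' \<in> F" "B \<subset> C'" "C' \<noteq> C" using up by blast
    \<comment> \<open>A second lower member would give two members below and two above, with B in between.\<close>
    have low: "X = A" if "X \<in> F" "X \<subset> B" for X
    proof (rule ccontr)
      assume "X \<noteq> A"
      then show False
        by (intro no_skew[of X A C' C B]) (use that C' F sub in auto)
    qed
    have max: "E = D" if "D \<in> F" "B \<subset> D" "E \<in> F" "D \<subseteq> E" for D E
    proof (rule ccontr)
      assume "E \<noteq> D"
      have "(C1 \<noteq> D \<and> C1 \<noteq> E) \<or> (C2 \<noteq> D \<and> C2 \<noteq> E)" using up \<open>D \<subseteq> E\<close> by auto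
      then obtain X where "X \<in> F" "B \<subset> X" "X \<noteq> D" "X \<noteq> E" using up by blast
      then show False
        by (intro no_skew[of A B X E D]) (use that F sub \<open>E \<noteq> D\<close> in auto)
    qed
    have "E = B" if "E \<in> F" "A \<subset> E" "E \<subset> C" for E
    proof (rule ccontr)
      assume "E \<noteq> B"
      have "\<not> C' \<subseteq> C" using max[OF C'(1,2) F(3)] C'(3) by auto
      then show False
        by (intro no_skew[of B A C' C E]) (use that F sub C' \<open>E \<noteq> B\<close> in auto)
    qed
    moreover have "E = A" if "E \<in> F" "E \<subseteq> A" for E
      using low[of E] that sub by blast
    ultimately show ?thesis using max[of C] F sub by blast
  next
    case True
    then obtain A1 A2 where dn: "A1 \<in> F" "A2 \<in> F" "A1 \<subset> B" "A2 \<subset> B"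
      "\<not> A1 \<subseteq> A2" "\<not> A2 \<subseteq> A1" using nonlin unfolding linear_member_def by blast
    obtain A' where A': "A' \<in> F" "A' \<subset> B" "A' \<noteq> A" using dn by blast
    \<comment> \<open>The next steps are dual to the previous case.\<close>
    have up: "X = C" if "X \<in> F" "B \<subset> X" for X
    proof (rule ccontr)
      assume "X \<noteq> C"
      then show False
        by (intro no_skew[of A' A X C B]) (use that A' F sub in auto)
    qed
    have min: "E = D" if "D \<in> F" "D \<subset> B" "E \<in> F" "E \<subseteq> D" for D E
    proof (rule ccontr)
      assume "E \<noteq> D"
      have "(A1 \<noteq> D \<and> A1 \<noteq> E) \<or> (A2 \<noteq> D \<and> A2 \<noteq> E)" using dn \<open>E \<subseteq> D\<close> by auto
      then obtain X where "X \<in> F" "X \<subset> B" "X \<noteq> D" "X \<noteq> E" using dn by blast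
      then show False
        by (intro no_skew[of X E C B D]) (use that F sub \<open>E \<noteq> D\<close> in auto)
    qed
    have "E = B" if "E \<in> F" "A \<subset> E" "E \<subset> C" for E
    proof (rule ccontr)
      assume "E \<noteq> B"
      have "\<not> A \<subseteq> A'" using min[OF A'(1,2) F(1)] A'(3) by auto
      then show False
        by (intro no_skew[of A' A B C E]) (use that F sub A' \<open>E \<noteq> B\<close> in auto)
    qed
    moreover have "E = C" if "E \<in> F" "C \<subseteq> E" for E
      using up[of E] that sub by blast
    ultimately show ?thesis using min[of A] F sub by blast
  qed
  then show "\<And>E. E \<in> F \<Longrightarrow> E \<subseteq> A \<Longrightarrow> E = A"
    "\<And>E. E \<in> F \<Longrightarrow> C \<subseteq> E \<Longrightarrow> E = C"
    "\<And>E. E \<in> F \<Longrightarrow> A \<subset> E \<Longrightarrow> E \<subset> C \<Longrightarrow> E = B" by blast+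
qed

section \<open>Detours in a skew-butterfly-free family\<close>

definition thin_flag :: "'a flag \<Rightarrow> bool" where
  "thin_flag p \<longleftrightarrow> order_of p \<in> permutations_of_set V \<and> lower_set p \<in> F \<and> middle_set p \<in> F \<and> upper_set p \<in> F \<and>
     (\<forall>E\<in>F. E \<subseteq> lower_set p \<longrightarrow> E = lower_set p) \<and>
     (\<forall>E\<in>F. upper_set p \<subseteq> E \<longrightarrow> E = upper_set p) \<and>
     (\<forall>E\<in>F. lower_set p \<subset> E \<longrightarrow> E \<subset> upper_set p \<longrightarrow> E = middle_set p)"

lemma thin_flagD:
  assumes "thin_flag p"
  shows "distinct (order_of p)" "set (order_of p) = V"
    "lower_set p \<in> F" "middle_set p \<in> F" "upper_set p \<in> F"
    "\<And>E. E \<in> F \<Longrightarrow> E \<subseteq> lower_set p \<Longrightarrow> E = lower_set p"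
    "\<And>E. E \<in> F \<Longrightarrow> upper_set p \<subseteq> E \<Longrightarrow> E = upper_set p"
    "\<And>E. E \<in> F \<Longrightarrow> lower_set p \<subset> E \<Longrightarrow> E \<subset> upper_set p \<Longrightarrow> E = middle_set p"
  using assms unfolding thin_flag_def permutations_of_set_def by blast+

lemma detours_are_orders:
  assumes "thin_flag p"
  shows "low_detour p \<in> permutations_of_set V" "high_detour p \<in> permutations_of_set V"
  using assms by (cases p; auto simp: thin_flag_def permutations_of_set_def)+

lemma flag_cards:
  assumes "thin_flag (Flag P x Y y z Z r Q)"
  shows "card (lower_set (Flag P x Y y z Z r Q)) = length P + 1"
    and "card (middle_set (Flag P x Y y z Z r Q)) = length P + length Y + 2"
    and "card (upper_set (Flag P x Y y z Z r Q)) = length P + length Y + length Z + 3"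
proof -
  have d: "distinct (P @ x # Y @ y # z # Z)"
    using thin_flagD(1)[OF assms] by auto
  have "lower_set (Flag P x Y y z Z r Q) = set (P @ [x])" by auto
  moreover have "distinct (P @ [x])" using d by auto
  ultimately show "card (lower_set (Flag P x Y y z Z r Q)) = length P + 1"
    using distinct_card by fastforce
  have "middle_set (Flag P x Y y z Z r Q) = set (P @ x # Y @ [y])" by auto
  moreover have "distinct (P @ x # Y @ [y])" using d by auto
  ultimately show "card (middle_set (Flag P x Y y z Z r Q)) = length P + length Y + 2"
    using distinct_card by fastforce
  have "upper_set (Flag P x Y y z Z r Q) = set (P @ x # Y @ y # z # Z)" by auto
  then show "card (upper_set (Flag P x Y y z Z r Q)) = length P + length Y + length Z + 3"
    using distinct_card[OF d] by simp
qed

lemma low_detour_trace: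
  assumes p: "thin_flag p" and free: "low_obstacle p \<notin> F"
  shows "trace (low_detour p) = {upper_set p}"
proof (cases p)
  case [simp]: (Flag P x Y y z Z r Q)
  note thin = thin_flagD[OF p, simplified]
  have "E = upper_set p" if E: "E \<in> trace (low_detour p)" for E
  proof -
    have EF: "E \<in> F" and Ep: "E \<in> prefix_sets (P @ z # x # Y @ y # Z @ r # Q)"
      using E by (auto simp: trace_def)
    have 1: "E \<subseteq> set P \<or> set P \<subseteq> E"
      using prefix_sets_split[OF Ep] .
    have 2: "E \<subseteq> insert z (set P) \<or> insert z (set P) \<subseteq> E"
      using prefix_sets_split[of E "P @ [z]" "x # Y @ y # Z @ r # Q"] Ep by auto
    have 3: "E \<subseteq> insert x (insert z (set P)) \<or> insert x (insert z (set P)) \<subseteq> E"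
      using prefix_sets_split[of E "P @ [z, x]" "Y @ y # Z @ r # Q"] Ep by auto
    have 4: "E \<subseteq> upper_set p \<or> upper_set p \<subseteq> E"
      using prefix_sets_split[of E "P @ z # x # Y @ y # Z" "r # Q"] Ep
      by (simp add: insert_commute Un_assoc)
    have "\<not> E \<subseteq> set P"
      using thin(1) thin(6)[OF EF] by auto
    then have "E \<subseteq> insert z (set P) \<Longrightarrow> E = insert z (set P)" using 1 by blast
    then have "\<not> E \<subseteq> insert z (set P)" using free EF by auto
    then have low: "insert x (insert z (set P)) \<subseteq> E" using 2 3 by auto
    have "E \<noteq> middle_set p" using low thin(1) by auto
    moreover have "lower_set p \<subset> E" using low thin(1) by auto
    ultimately show ?thesis
      using thin_flagD(7,8)[OF p EF] 4 by blast
  qed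
  moreover have "upper_set p \<in> trace (low_detour p)"
    using thin(5) prefix_setsI[of "P @ z # x # Y @ y # Z" "r # Q"]
    by (simp add: trace_def insert_commute Un_assoc)
  ultimately show ?thesis by blast
qed

lemma high_detour_trace:
  assumes p: "thin_flag p" and free: "high_obstacle p \<notin> F"
  shows "trace (high_detour p) = {lower_set p}"
proof (cases p)
  case [simp]: (Flag P x Y y z Z r Q)
  note thin = thin_flagD[OF p, simplified]
  have "E = lower_set p" if E: "E \<in> trace (high_detour p)" for E
  proof -
    have EF: "E \<in> F" and Ep: "E \<in> prefix_sets (P @ x # Y @ z # Z @ r # y # Q)"
      using E by (auto simp: trace_def)
    let ?M = "set P \<union> set Y \<union> set Z"
    have 1: "E \<subseteq> lower_set p \<or> lower_set p \<subseteq> E"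
      using prefix_sets_split[of E "P @ [x]" "Y @ z # Z @ r # y # Q"] Ep by auto
    have 2: "E \<subseteq> insert x (insert z ?M) \<or> insert x (insert z ?M) \<subseteq> E"
      using prefix_sets_split[of E "P @ x # Y @ z # Z" "r # y # Q"] Ep
      by (simp add: insert_commute Un_assoc)
    have 3: "E \<subseteq> high_obstacle p \<or> high_obstacle p \<subseteq> E"
      using prefix_sets_split[of E "P @ x # Y @ z # Z @ [r]" "y # Q"] Ep
      by (simp add: insert_commute Un_assoc)
    have 4: "E \<subseteq> insert y (high_obstacle p) \<or> insert y (high_obstacle p) \<subseteq> E"
      using prefix_sets_split[of E "P @ x # Y @ z # Z @ [r, y]" "Q"] Ep
      by (simp add: insert_commute Un_assoc)
    have "\<not> insert y (high_obstacle p) \<subseteq> E"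
      using thin(1) thin_flagD(7)[OF p EF] by auto
    then have "E \<subseteq> high_obstacle p" using 3 4 free EF by auto
    moreover have "E \<noteq> high_obstacle p" using free EF by blast
    ultimately have high: "E \<subseteq> insert x (insert z ?M)" using 2 by auto
    have "E \<noteq> middle_set p" using high thin(1) by auto
    moreover have "E \<subset> upper_set p" using high thin(1) by auto
    ultimately show ?thesis
      using thin_flagD(6,8)[OF p EF] 1 by blast
  qed
  moreover have "lower_set p \<in> trace (high_detour p)"
    using thin(3) prefix_setsI[of "P @ [x]" "Y @ z # Z @ r # y # Q"]
    by (simp add: trace_def)
  ultimately show ?thesis by blast
qed

lemma flag_sets_strict:
  assumes "thin_flag p"
  shows "lower_set p \<subset> middle_set p" "middle_set p \<subset> upper_set p"
proof -
  have "\<not> middle_set p \<subseteq> lower_set p" "\<not> upper_set p \<subseteq> middle_set p"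
    "lower_set p \<subseteq> middle_set p" "middle_set p \<subseteq> upper_set p"
    using thin_flagD(1)[OF assms] by (cases p; auto)+
  then show "lower_set p \<subset> middle_set p" "middle_set p \<subset> upper_set p" by blast+
qed

text \<open>
With \<open>L\<close> and \<open>H\<close> for the low and the high obstacle, \<open>A \<subset> B \<subset> C\<close> and \<open>L \<subset> H\<close> together with \<open>L \<subset> C\<close>
and \<open>A \<subset> H\<close> are the relations of the skew-butterfly.
\<close>

lemma some_detour_free:
  assumes p: "thin_flag p"
  shows "low_obstacle p \<notin> F \<or> high_obstacle p \<notin> F"
proof (rule ccontr)
  assume "\<not> ?thesis"
  then have obs: "low_obstacle p \<in> F" "high_obstacle p \<in> F" by auto
  have "\<not> lower_set p \<subseteq> low_obstacle p" "\<not> high_obstacle p \<subseteq> upper_set p"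
    "low_obstacle p \<subseteq> high_obstacle p" "lower_set p \<subseteq> high_obstacle p"
    "low_obstacle p \<subseteq> upper_set p"
    using thin_flagD(1)[OF p] by (cases p; auto)+
  moreover note flag_sets_strict[OF p]
  ultimately have "distinct [low_obstacle p, lower_set p, high_obstacle p, upper_set p, middle_set p]"
    "low_obstacle p \<subseteq> high_obstacle p" "low_obstacle p \<subseteq> upper_set p"
    "lower_set p \<subseteq> high_obstacle p" "lower_set p \<subseteq> middle_set p" "middle_set p \<subseteq> upper_set p"
    by auto
  with obs thin_flagD(3-5)[OF p] show False
    by (intro no_skew[of "low_obstacle p" "lower_set p" "high_obstacle p" "upper_set p" "middle_set p"])
qed

text \<open>
Two different flags with the same high detour share \<open>A\<close>, which is the only member on that detour. If
\<open>C\<close> has fewer elements than \<open>C'\<close>, then \<open>C'\<close> contains everything that the detour enumerates before \<open>r\<close>, hence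
all of \<open>C\<close> except \<open>y\<close>. This puts the low obstacle of the first flag below both \<open>C\<close> and \<open>C'\<close>, so it is
not a member: it would complete \<open>A \<subset> B \<subset> C\<close> and \<open>A \<subset> C'\<close> to a skew-butterfly.
\<close>

lemma high_detour_collision:
  assumes p: "thin_flag p" "high_obstacle p \<notin> F" and p': "thin_flag p'" "high_obstacle p' \<notin> F"
    and eq: "high_detour p = high_detour p'" and ne: "p \<noteq> p'"
  shows "lower_set p = lower_set p'" "card (upper_set p) \<noteq> card (upper_set p')"
    "card (upper_set p) < card (upper_set p') \<Longrightarrow> upper_set p - middle_set p \<subseteq> upper_set p'"
    "card (upper_set p) < card (upper_set p') \<Longrightarrow> low_obstacle p \<notin> F"
proof -
  show low: "lower_set p = lower_set p'"
    using high_detour_trace[OF p] high_detour_trace[OF p'] eq by simp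
  obtain P x Y y z Z r Q where pd: "p = Flag P x Y y z Z r Q" by (cases p)
  obtain P' x' Y' y' z' Z' r' Q' where pd': "p' = Flag P' x' Y' y' z' Z' r' Q'" by (cases p')
  note strict = flag_sets_strict[OF p(1)] and strict' = flag_sets_strict[OF p'(1)]
  note cards = flag_cards[OF p(1)[unfolded pd], folded pd]
  note cards' = flag_cards[OF p'(1)[unfolded pd'], folded pd']
  have len: "length P = length P'"
    using low cards(1) cards'(1) by simp
  then have PX: "P = P'" "x = x'"
    and rest: "(Y @ z # Z) @ r # y # Q = (Y' @ z' # Z') @ r' # y' # Q'"
    using eq by (auto simp: pd pd')
  show "card (upper_set p) \<noteq> card (upper_set p')"
  proof
    assume ceq: "card (upper_set p) = card (upper_set p')"
    have "length (Y @ z # Z) = length (Y' @ z' # Z')"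
      using ceq cards(3) cards'(3) len by simp
    with rest have "Y @ z # Z = Y' @ z' # Z' \<and> r # y # Q = r' # y' # Q'"
      by (metis append_eq_append_conv)
    then have e: "Y @ z # Z = Y' @ z' # Z'" "r = r'" "y = y'" "Q = Q'" by auto
    have "insert z (set Y \<union> set Z) = insert z' (set Y' \<union> set Z')"
      using arg_cong[OF e(1), of set] by simp
    moreover have "upper_set p = insert x (insert y (set P \<union> insert z (set Y \<union> set Z)))"
      "upper_set p' = insert x' (insert y' (set P' \<union> insert z' (set Y' \<union> set Z')))"
      by (auto simp: pd pd')
    ultimately have "upper_set p = upper_set p'" using e PX by simp
    then have "middle_set p' = middle_set p"
      using thin_flagD(8)[OF p(1) thin_flagD(4)[OF p'(1)]] strict' low by simp
    then have "length Y = length Y'"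
      using cards(2) cards'(2) len by simp
    then show False using e PX ne by (simp add: pd pd')
  qed
  assume less: "card (upper_set p) < card (upper_set p')"
  then have "length (Y @ z # Z) \<le> length (Y' @ z' # Z')"
    using cards(3) cards'(3) len by simp
  then obtain W where "Y' @ z' # Z' = (Y @ z # Z) @ W"
    by (rule append_eq_longer[OF rest])
  \<comment> \<open>Before reaching r the first flag's detour has enumerated P, x, Y, z, Z, and the second one's
    has not yet come to r', so all these elements belong to the larger upper set.\<close>
  from arg_cong[OF this, of set] have sub: "insert z (set Y \<union> set Z) \<subseteq> upper_set p'"
    by (auto simp: pd')
  then show "upper_set p - middle_set p \<subseteq> upper_set p'" by (auto simp: pd)
  show "low_obstacle p \<notin> F"
  proof
    assume obs: "low_obstacle p \<in> F"
    have "\<not> lower_set p \<subseteq> low_obstacle p" "low_obstacle p \<subseteq> upper_set p"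
      using thin_flagD(1)[OF p(1)] by (auto simp: pd)
    moreover have "low_obstacle p \<subseteq> upper_set p'"
      using sub PX by (auto simp: pd pd')
    moreover have "lower_set p \<subset> upper_set p'" using strict' low by auto
    moreover have "\<not> upper_set p' \<subseteq> upper_set p"
      using less thin_flagD(7)[OF p'(1) thin_flagD(5)[OF p(1)]] by auto
    moreover note strict
    ultimately have "distinct [low_obstacle p, lower_set p, upper_set p', upper_set p, middle_set p]"
      "low_obstacle p \<subseteq> upper_set p'" "low_obstacle p \<subseteq> upper_set p"
      "lower_set p \<subseteq> upper_set p'" "lower_set p \<subseteq> middle_set p" "middle_set p \<subseteq> upper_set p"
      by auto
    with obs thin_flagD(3-5)[OF p(1)] thin_flagD(5)[OF p'(1)] show False
      by (intro no_skew[of "low_obstacle p" "lower_set p" "upper_set p'" "upper_set p" "middle_set p"])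
  qed
qed

text \<open>
The dual statement: the flags share \<open>C\<close>, and if \<open>A\<close> has fewer elements than \<open>A'\<close>, then the common detour
shows that \<open>A\<close> is contained in \<open>A'\<close> together with one element of \<open>C - B'\<close>. So \<open>A\<close> lies below the high
obstacle of the second flag, which therefore is not a member.
\<close>

lemma low_detour_collision:
  assumes p: "thin_flag p" "low_obstacle p \<notin> F" and p': "thin_flag p'" "low_obstacle p' \<notin> F"
    and eq: "low_detour p = low_detour p'" and ne: "p \<noteq> p'"
  shows "upper_set p = upper_set p'" "card (lower_set p) \<noteq> card (lower_set p')"
    "card (lower_set p) < card (lower_set p') \<Longrightarrow>
      lower_set p \<subseteq> lower_set p' \<union> (upper_set p' - middle_set p')"
    "card (lower_set p) < card (lower_set p') \<Longrightarrow> high_obstacle p' \<notin> F"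
proof -
  show up: "upper_set p = upper_set p'"
    using low_detour_trace[OF p] low_detour_trace[OF p'] eq by simp
  obtain P x Y y z Z r Q where pd: "p = Flag P x Y y z Z r Q" by (cases p)
  obtain P' x' Y' y' z' Z' r' Q' where pd': "p' = Flag P' x' Y' y' z' Z' r' Q'" by (cases p')
  note strict = flag_sets_strict[OF p(1)] and strict' = flag_sets_strict[OF p'(1)]
  note cards = flag_cards[OF p(1)[unfolded pd], folded pd]
  note cards' = flag_cards[OF p'(1)[unfolded pd'], folded pd']
  have eq': "P @ z # x # Y @ y # Z @ r # Q = P' @ z' # x' # Y' @ y' # Z' @ r' # Q'"
    using eq by (simp add: pd pd')
  show "card (lower_set p) \<noteq> card (lower_set p')"
  proof
    assume ceq: "card (lower_set p) = card (lower_set p')"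
    then have len: "length P = length P'" using cards(1) cards'(1) by simp
    with eq' have e: "P = P'" "z = z'" "x = x'" "Y @ y # Z @ r # Q = Y' @ y' # Z' @ r' # Q'"
      by auto
    then have "lower_set p = lower_set p'" by (simp add: pd pd')
    then have "middle_set p' = middle_set p"
      using thin_flagD(8)[OF p(1) thin_flagD(4)[OF p'(1)]] strict' up by simp
    then have lY: "length Y = length Y'"
      using cards(2) cards'(2) len by simp
    moreover have "length Z = length Z'"
      using cards(3) cards'(3) len lY up by simp
    ultimately show False using e ne by (simp add: pd pd')
  qed
  assume less: "card (lower_set p) < card (lower_set p')"
  then have len: "length P < length P'" using cards(1) cards'(1) by simp
  obtain U where U: "P' = P @ U"
    "z # x # Y @ y # Z @ r # Q = U @ z' # x' # Y' @ y' # Z' @ r' # Q'"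
    by (rule append_eq_longer[OF eq' less_imp_le[OF len]])
  with len obtain W where W: "P' = P @ z # W"
    "x # Y @ y # Z @ r # Q = W @ z' # x' # Y' @ y' # Z' @ r' # Q'"
    by (cases U) auto
  have nsub: "\<not> lower_set p \<subseteq> lower_set p'"
    using thin_flagD(6)[OF p'(1) thin_flagD(3)[OF p(1)]] less by auto
  \<comment> \<open>If the second flag's P' were longer than P by more than z, it would contain x as well,
    and then A would lie inside the minimal member A'.\<close>
  have "x = z'"
  proof (cases W)
    case (Cons w W')
    then have "lower_set p \<subseteq> lower_set p'" using W by (auto simp: pd pd')
    with nsub show ?thesis by blast
  qed (use W in auto)
  moreover have "z' \<in> upper_set p' - middle_set p'"
    using thin_flagD(1)[OF p'(1)] by (auto simp: pd')
  ultimately show sub: "lower_set p \<subseteq> lower_set p' \<union> (upper_set p' - middle_set p')"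
    using W(1) by (auto simp: pd pd')
  show "high_obstacle p' \<notin> F"
  proof
    assume obs: "high_obstacle p' \<in> F"
    have "lower_set p \<subseteq> high_obstacle p'" using \<open>x = z'\<close> W(1) by (auto simp: pd pd')
    moreover have "lower_set p \<subset> upper_set p'" using strict up by auto
    moreover have "\<not> high_obstacle p' \<subseteq> upper_set p'" "lower_set p' \<subseteq> high_obstacle p'"
      using thin_flagD(1)[OF p'(1)] by (auto simp: pd')
    moreover have "lower_set p \<noteq> middle_set p'"
      using thin_flagD(6)[OF p(1) thin_flagD(3)[OF p'(1)]] strict' nsub by auto
    moreover note strict' nsub
    ultimately have "distinct [lower_set p, lower_set p', high_obstacle p', upper_set p', middle_set p']"
      "lower_set p \<subseteq> high_obstacle p'" "lower_set p \<subseteq> upper_set p'"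
      "lower_set p' \<subseteq> high_obstacle p'" "lower_set p' \<subseteq> middle_set p'" "middle_set p' \<subseteq> upper_set p'"
      by auto
    with obs thin_flagD(3-5)[OF p'(1)] thin_flagD(3)[OF p(1)] show False
      by (intro no_skew[of "lower_set p" "lower_set p'" "high_obstacle p'" "upper_set p'" "middle_set p'"])
  qed
qed

text \<open>
This separates the images of the two kinds of modification: a reversal leaves a sandwiched member
alone on its chain, a detour leaves a minimal or a maximal one.
\<close>

definition sandwiched :: "'a set \<Rightarrow> bool" where
  "sandwiched E \<longleftrightarrow> (\<exists>A\<in>F. A \<subset> E) \<and> (\<exists>C\<in>F. E \<subset> C)"

lemma flag_ends_not_sandwiched:
  assumes "thin_flag p"
  shows "\<not> sandwiched (lower_set p)" "\<not> sandwiched (upper_set p)"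
  using thin_flagD(6,7)[OF assms] unfolding sandwiched_def by blast+

text \<open>
The high detour is taken when it is available and the flag is not the one with the smaller \<open>C\<close> in some
collision of high detours; otherwise the low detour, which is then available. Two high detours
collide only if one of the flags has the smaller \<open>C\<close>, and that flag was sent the other way. If two
low detours collide, the flag with the larger \<open>A\<close> has its high detour available, so it must have been
turned away by a collision of high detours with a flag of larger \<open>C\<close>; these two collisions at one flag
produce a skew-butterfly.
\<close>

lemma detour_injection:
  obtains h where "inj_on h {p. thin_flag p}"
    and "\<And>p. thin_flag p \<Longrightarrow> h p \<in> permutations_of_set V \<and>
           (\<exists>E. trace (h p) = {E} \<and> \<not> sandwiched E)"
proof -
  define crowded where "crowded p \<longleftrightarrow> (\<exists>p'. thin_flag p' \<and> high_obstacle p' \<notin> F \<and>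
      high_detour p = high_detour p' \<and> card (upper_set p) < card (upper_set p'))" for p
  define h where "h p = (if high_obstacle p \<notin> F \<and> \<not> crowded p then high_detour p else low_detour p)" for p
  \<comment> \<open>Whenever h takes the low detour, that detour is available.\<close>
  have low_free: "low_obstacle p \<notin> F"
    if p: "thin_flag p" and turn: "\<not> (high_obstacle p \<notin> F \<and> \<not> crowded p)" for p
  proof (cases "high_obstacle p \<in> F")
    case True
    then show ?thesis using some_detour_free p by blast
  next
    case False
    then obtain p' where p': "thin_flag p'" "high_obstacle p' \<notin> F"
      "high_detour p = high_detour p'" "card (upper_set p) < card (upper_set p')"
      using turn unfolding crowded_def by blast
    then have "p \<noteq> p'" by auto
    then show ?thesis
      using high_detour_collision(4)[OF p False p'(1-3)] p'(4) by blast
  qed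
  have lower_collision: False
    if p: "thin_flag p" "low_obstacle p \<notin> F" and p': "thin_flag p'" "low_obstacle p' \<notin> F"
      and eq: "low_detour p = low_detour p'" and less: "card (lower_set p) < card (lower_set p')"
      and turn: "\<not> (high_obstacle p' \<notin> F \<and> \<not> crowded p')" for p p'
  proof -
    have ne: "p \<noteq> p'" using less by auto
    note coll = low_detour_collision[OF p p' eq ne]
    have free': "high_obstacle p' \<notin> F" using coll(4) less by blast
    with turn obtain q where q: "thin_flag q" "high_obstacle q \<notin> F"
      "high_detour p' = high_detour q" "card (upper_set p') < card (upper_set q)"
      unfolding crowded_def by blast
    then have "p' \<noteq> q" by auto
    note collq = high_detour_collision[OF p'(1) free' q(1-3) this]
    \<comment> \<open>The smaller lower set of p consists of elements of A' and of C' - B', and the larger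
      upper set of q contains both of these: this is what makes the two collisions incompatible.\<close>
    have sub: "lower_set p \<subseteq> upper_set q"
    proof -
      have "lower_set p' \<subseteq> upper_set q"
        using collq(1) flag_sets_strict[OF q(1)] by auto
      then show ?thesis using coll(3)[OF less] collq(3)[OF q(4)] by auto
    qed
    have "\<not> lower_set p \<subseteq> lower_set p'"
      using thin_flagD(6)[OF p'(1) thin_flagD(3)[OF p(1)]] less by auto
    moreover have "lower_set p \<noteq> middle_set p'" 
      using thin_flagD(6)[OF p(1) thin_flagD(3)[OF p'(1)]] flag_sets_strict[OF p'(1)] calculation
      by auto
    moreover have "lower_set p \<subset> upper_set p'"
      using coll(1) flag_sets_strict[OF p(1)] by auto
    moreover have "\<not> upper_set q \<subseteq> upper_set p'"
      using thin_flagD(7)[OF q(1) thin_flagD(5)[OF p'(1)]] q(4) by auto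
    moreover have "lower_set p' \<subset> upper_set q"
      using collq(1) flag_sets_strict[OF q(1)] by auto
    moreover note flag_sets_strict[OF p'(1)] sub
    ultimately have "distinct [lower_set p, lower_set p', upper_set q, upper_set p', middle_set p']"
      "lower_set p \<subseteq> upper_set q" "lower_set p \<subseteq> upper_set p'"
      "lower_set p' \<subseteq> upper_set q" "lower_set p' \<subseteq> middle_set p'" "middle_set p' \<subseteq> upper_set p'"
      by auto
    with thin_flagD(3-5)[OF p'(1)] thin_flagD(3)[OF p(1)] thin_flagD(5)[OF q(1)] show False
      by (intro no_skew[of "lower_set p" "lower_set p'" "upper_set q" "upper_set p'" "middle_set p'"])
  qed
  have tr: "trace (h p) = {if high_obstacle p \<notin> F \<and> \<not> crowded p then lower_set p else upper_set p}"
    if p: "thin_flag p" for p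
    using high_detour_trace[OF p] low_detour_trace[OF p] low_free[OF p] by (auto simp: h_def)
  have "inj_on h {p. thin_flag p}"
  proof (rule inj_onI, rule ccontr)
    fix p p' assume "p \<in> {p. thin_flag p}" "p' \<in> {p. thin_flag p}" and heq: "h p = h p'" and ne: "p \<noteq> p'"
    then have p: "thin_flag p" and p': "thin_flag p'" by auto
    let ?H = "\<lambda>p. high_obstacle p \<notin> F \<and> \<not> crowded p"
    have seq: "(if ?H p then lower_set p else upper_set p) = (if ?H p' then lower_set p' else upper_set p')"
      using tr[OF p] tr[OF p'] heq by simp
    \<comment> \<open>The only member on the image tells which detour was taken: a lower set is minimal, an upper
      set is not.\<close>
    have mix: "lower_set q \<noteq> upper_set q'" if q: "thin_flag q" "thin_flag q'" for q q'
    proof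
      assume *: "lower_set q = upper_set q'"
      have "lower_set q' \<subset> lower_set q"
        using flag_sets_strict[OF q(2)] unfolding * by auto
      then show False
        using thin_flagD(6)[OF q(1) thin_flagD(3)[OF q(2)]] by auto
    qed
    have same: "?H p \<longleftrightarrow> ?H p'"
      using seq mix[OF p p'] mix[OF p' p] by (metis (full_types))
    show False
    proof (cases "?H p")
      case True
      with same have H: "?H p" "?H p'" by auto
      then have eq: "high_detour p = high_detour p'" using heq by (simp add: h_def)
      have "card (upper_set p) \<noteq> card (upper_set p')"
        using high_detour_collision(2)[OF p _ p' _ eq ne] H by blast
      then show False
        using H p p' eq unfolding crowded_def by (metis linorder_neqE_nat)
    next
      case False
      with same have H: "\<not> ?H p" "\<not> ?H p'" by auto
      then have eq: "low_detour p = low_detour p'" using heq by (auto simp: h_def)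
      note free = low_free[OF p H(1)] low_free[OF p' H(2)]
      have "card (lower_set p) \<noteq> card (lower_set p')"
        using low_detour_collision(2)[OF p free(1) p' free(2) eq ne] .
      then show False
        using lower_collision[OF p free(1) p' free(2) eq _ H(2)]
          lower_collision[OF p' free(2) p free(1) eq[symmetric] _ H(1)] by linarith
    qed
  qed
  moreover have "h p \<in> permutations_of_set V \<and> (\<exists>E. trace (h p) = {E} \<and> \<not> sandwiched E)"
    if p: "thin_flag p" for p
    using tr[OF p] detours_are_orders[OF p] flag_ends_not_sandwiched[OF p]
    by (auto simp: h_def)
  ultimately show thesis by (rule that)
qed

text \<open>
The ends of the flag exist because the empty set and \<open>V\<close> are not members.
\<close>

lemma interior_flag:
  assumes xs: "xs \<in> permutations_of_set V" and B: "B \<in> interior xs" and nonlin: "\<not> linear_member B"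
  obtains p where "thin_flag p" "order_of p = xs" "middle_set p = B"
proof -
  obtain A C where A: "A \<in> trace xs" "A \<subset> B" and C: "C \<in> trace xs" "B \<subset> C" and BT: "B \<in> trace xs"
    using B unfolding interior_def by blast
  have F: "A \<in> F" "B \<in> F" "C \<in> F" using A(1) BT C(1) by (auto simp: trace_def)
  obtain as as' bs bs' cs cs' where
    xA: "xs = as @ as'" "A = set as" and xB: "xs = bs @ bs'" "B = set bs" and xC: "xs = cs @ cs'" "C = set cs"
    using A(1) BT C(1) unfolding trace_def prefix_sets_def by blast
  have ext: "\<exists>ws. vs = us @ ws \<and> ws \<noteq> []" if "us @ us' = vs @ vs'" "set us \<subset> set vs"
    for us us' vs vs' :: "'a list"
    using that by (auto simp: append_eq_append_conv2)
  obtain W where W: "bs = as @ W" "W \<noteq> []" using ext[of as as' bs bs'] xA xB A(2) by auto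
  obtain W' where W': "cs = bs @ W'" "W' \<noteq> []" using ext[of bs bs' cs cs'] xC xB C(2) by auto
  have "as \<noteq> []" using xA(2) F(1) empty_notin by auto
  then obtain P x where P: "as = P @ [x]" by (metis rev_exhaust)
  obtain Y y where Y: "W = Y @ [y]" using W(2) by (metis rev_exhaust)
  obtain z Z where Z: "W' = z # Z" using W'(2) by (cases W') auto
  have "cs' \<noteq> []" using xC F(3) V_notin xs by (auto simp: permutations_of_set_def)
  then obtain r Q where Q: "cs' = r # Q" by (cases cs') auto
  let ?p = "Flag P x Y y z Z r Q"
  have sets: "lower_set ?p = A" "middle_set ?p = B" "upper_set ?p = C"
    using xA(2) xB(2) xC(2) W(1) W'(1) P Y Z by auto
  have ord: "order_of ?p = xs" using xC(1) W(1) W'(1) P Y Z Q by simp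
  have "thin_flag ?p"
    unfolding thin_flag_def sets ord
    using xs F nonlinear_thin[OF F A(2) C(2) nonlin] by blast
  then show thesis using that ord sets by blast
qed

section \<open>The bound on the Lubell sum\<close>

lemma card_interior_pairs_le:
  "card (SIGMA xs:permutations_of_set V. interior xs)
     \<le> card {xs \<in> permutations_of_set V. card (trace xs) = 1}"
proof -
  let ?\<Pi> = "permutations_of_set V"
  define pairs where "pairs = (SIGMA xs:?\<Pi>. interior xs)"
  define lin where "lin = {(xs, B) \<in> pairs. linear_member B}"
  define solo where "solo b = {xs \<in> ?\<Pi>. \<exists>E. trace xs = {E} \<and> sandwiched E = b}" for b
  have fin: "finite (solo b)" for b unfolding solo_def by simp
  define reversal where "reversal = (\<lambda>(xs :: 'a list, B :: 'a set). rev (take (card B) xs) @ rev (drop (card B) xs))"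
  have rev_trace: "trace (reversal (xs, B)) = {B}" "sandwiched B" "reversal (xs, B) \<in> ?\<Pi>"
    if "(xs, B) \<in> lin" for xs B
  proof -
    have xs: "xs \<in> ?\<Pi>" and B: "B \<in> interior xs" and l: "linear_member B"
      using that by (auto simp: lin_def pairs_def)
    obtain A C where AC: "A \<in> trace xs" "A \<subset> B" "C \<in> trace xs" "B \<subset> C" and BT: "B \<in> trace xs"
      using B unfolding interior_def by blast
    then have BF: "B \<in> F" "B \<in> prefix_sets xs" by (auto simp: trace_def)
    have eq: "set (take (card B) xs) = B"
      using prefix_sets_take[OF _ BF(2)] xs by (simp add: permutations_of_set_def)
    show "trace (reversal (xs, B)) = {B}"
      using reversal_trace[of "take (card B) xs" "drop (card B) xs" A C] xs BF l AC
      by (simp add: eq reversal_def)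
    show "sandwiched B" using AC unfolding sandwiched_def trace_def by blast
    have "set (reversal (xs, B)) = set (take (card B) xs @ drop (card B) xs)"
      by (simp only: reversal_def prod.case set_append set_rev)
    moreover have "distinct (reversal (xs, B)) = distinct (take (card B) xs @ drop (card B) xs)"
      by (simp only: reversal_def prod.case distinct_append set_rev distinct_rev)
    ultimately show "reversal (xs, B) \<in> ?\<Pi>"
      using xs by (simp add: permutations_of_set_def)
  qed
  \<comment> \<open>Reversal is undone by repeating it, once the cut is known; the cut is at the size of the only
    member on the reversed chain.\<close>
  have "inj_on reversal lin"
  proof (rule inj_onI)
    fix p q assume p: "p \<in> lin" and q: "q \<in> lin" and eq: "reversal p = reversal q"
    obtain xs B ys D where pq: "p = (xs, B)" "q = (ys, D)" by (cases p, cases q)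
    have BD: "B = D" using rev_trace(1)[of xs B] rev_trace(1)[of ys D] p q eq pq by simp
    have "length xs = length ys"
      using p q by (auto simp: pq lin_def pairs_def dest!: length_finite_permutations_of_set)
    then have "take (card B) xs = take (card B) ys \<and> drop (card B) xs = drop (card B) ys"
      using eq by (simp add: pq BD reversal_def)
    then show "p = q" using pq BD by (metis append_take_drop_id)
  qed
  moreover have "reversal ` lin \<subseteq> solo True"
  proof
    fix ys assume "ys \<in> reversal ` lin"
    then obtain xs B where "(xs, B) \<in> lin" "ys = reversal (xs, B)" by auto
    then show "ys \<in> solo True" using rev_trace[of xs B] by (simp add: solo_def)
  qed
  ultimately have 1: "card lin \<le> card (solo True)"
    using fin card_inj_on_le by blast
  obtain h where h: "inj_on h {p. thin_flag p}"
    "\<And>p. thin_flag p \<Longrightarrow> h p \<in> ?\<Pi> \<and> (\<exists>E. trace (h p) = {E} \<and> \<not> sandwiched E)"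
    using detour_injection by metis
  have "\<exists>p. thin_flag p \<and> (order_of p, middle_set p) = q" if q: "q \<in> pairs - lin" for q
  proof -
    obtain xs B where xB: "q = (xs, B)" by (cases q)
    with q have "xs \<in> ?\<Pi>" "B \<in> interior xs" "\<not> linear_member B"
      by (auto simp: pairs_def lin_def)
    then show ?thesis using interior_flag[of xs B] xB by metis
  qed
  then obtain flag where flag: "\<And>q. q \<in> pairs - lin \<Longrightarrow>
      thin_flag (flag q) \<and> (order_of (flag q), middle_set (flag q)) = q"
    by metis
  have "inj_on (h \<circ> flag) (pairs - lin)"
  proof (rule comp_inj_on)
    show "inj_on flag (pairs - lin)" using flag by (metis inj_onI)
    show "inj_on h (flag ` (pairs - lin))"
      using h(1) by (rule inj_on_subset) (use flag in auto)
  qed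
  moreover have "(h \<circ> flag) ` (pairs - lin) \<subseteq> solo False"
  proof
    fix ys assume "ys \<in> (h \<circ> flag) ` (pairs - lin)"
    then obtain q where "thin_flag (flag q)" "ys = h (flag q)" using flag by auto
    then show "ys \<in> solo False" using h(2)[of "flag q"] by (simp add: solo_def)
  qed
  ultimately have 2: "card (pairs - lin) \<le> card (solo False)"
    using fin card_inj_on_le by blast
  have "lin \<union> (pairs - lin) = pairs" by (auto simp: lin_def)
  then have "card pairs \<le> card lin + card (pairs - lin)"
    using card_Un_le[of lin "pairs - lin"] by simp
  also have "\<dots> \<le> card (solo True) + card (solo False)" using 1 2 by simp
  also have "\<dots> = card (solo True \<union> solo False)"
    using fin by (intro card_Un_disjoint[symmetric]) (auto simp: solo_def)
  also have "\<dots> \<le> card {xs \<in> ?\<Pi>. card (trace xs) = 1}"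
    by (intro card_mono) (auto simp: solo_def)
  finally show ?thesis unfolding pairs_def .
qed

lemma lubell_sum_le_2: "(\<Sum>E\<in>F. 1 / real (card V choose card E)) \<le> 2"
proof -
  let ?\<Pi> = "permutations_of_set V"
  have finT: "finite (trace xs)" for xs using finite_F by (simp add: trace_def)
  have "(\<Sum>xs\<in>?\<Pi>. card (trace xs)) + card {xs \<in> ?\<Pi>. card (trace xs) = 1}
      = (\<Sum>xs\<in>?\<Pi>. card (trace xs) + (if card (trace xs) = 1 then 1 else 0))"
    by (simp add: sum.distrib sum.If_cases Int_def)
  also have "\<dots> \<le> (\<Sum>xs\<in>?\<Pi>. 2 + card (interior xs))"
    unfolding interior_def
    by (intro sum_mono card_chain_le_interior finT) (auto simp: trace_def dest: prefix_sets_chain)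
  also have "\<dots> = 2 * fact (card V) + card (SIGMA xs:?\<Pi>. interior xs)"
  proof -
    have "\<forall>xs\<in>?\<Pi>. finite (interior xs)" using finT by (simp add: interior_def)
    then show ?thesis using finite_V by (simp only: card_SigmaI finite_permutations_of_set sum.distrib) simp
  qed
  finally have "(\<Sum>xs\<in>?\<Pi>. card (trace xs)) \<le> 2 * fact (card V)"
    using card_interior_pairs_le by linarith
  then have "real (\<Sum>xs\<in>?\<Pi>. card (trace xs)) \<le> real (2 * fact (card V))"
    by (simp only: of_nat_le_iff)
  then have "(\<Sum>xs\<in>?\<Pi>. real (card (trace xs))) \<le> 2 * fact (card V)"
    by simp
  then show ?thesis
    unfolding lubell_sum_eq_average[OF finite_V F_sub] trace_def[symmetric]
    by (simp add: divide_le_eq)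
qed

end

lemma weak_subposet_skewI:
  assumes "a \<in> F" "b \<in> F" "c \<in> F" "d \<in> F" "e \<in> F" "distinct [a, b, c, d, e]"
    "a \<subseteq> c" "a \<subseteq> d" "b \<subseteq> c" "b \<subseteq> e" "e \<subseteq> d"
  shows "weak_subposet (UNIV :: skew_butterfly set) skew_le F (\<subseteq>)"
proof -
  define \<phi> where "\<phi> = case_skew_butterfly a b c d e"
  have "inj \<phi>"
  proof (rule injI)
    fix x y assume "\<phi> x = \<phi> y"
    then show "x = y" using assms(6) by (cases x; cases y) (auto simp: \<phi>_def)
  qed
  moreover have "range \<phi> \<subseteq> F"
  proof
    fix E assume "E \<in> range \<phi>"
    then obtain x where "E = \<phi> x" by blast
    then show "E \<in> F" using assms(1-5) by (cases x) (auto simp: \<phi>_def)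
  qed
  moreover have "\<phi> x \<subseteq> \<phi> y" if "skew_le x y" for x y
    using that unfolding skew_le_def
  proof (induction rule: rtranclp_induct)
    case (step y z)
    from step.hyps(2) have "\<phi> y \<subseteq> \<phi> z"
      using assms(7-11) by cases (auto simp: \<phi>_def)
    with step.IH show ?case by blast
  qed simp
  ultimately show ?thesis
    unfolding weak_subposet_def monotone_on_def by blast
qed

theorem theorem3:
  fixes n :: nat and \<A> :: "nat set set"
  assumes "n \<ge> 3"
    and "\<A> \<subseteq> Pow {1..n}"
    and "\<not> weak_subposet (UNIV :: skew_butterfly set) skew_le \<A> (\<subseteq>)"
    and "{} \<notin> \<A>"
    and "{1..n} \<notin> \<A>"
  shows "(\<Sum>A\<in>\<A>. 1 / real (n choose card A)) \<le> 2"
proof -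
  interpret skew_free_family "{1..n}" \<A>
  proof
    show "finite {1..n}" by simp
    show False if "a \<in> \<A>" "b \<in> \<A>" "c \<in> \<A>" "d \<in> \<A>" "e \<in> \<A>" "distinct [a, b, c, d, e]"
      "a \<subseteq> c" "a \<subseteq> d" "b \<subseteq> c" "b \<subseteq> e" "e \<subseteq> d" for a b c d e
      using weak_subposet_skewI[OF that] assms(3) by contradiction
  qed (use assms in auto)
  show ?thesis using lubell_sum_le_2 by simp
qed

end
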